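(* Let $d\ge1$ and let $\mathbf S=B^\top B\in\mathbb R^{d\times d}$ for a real matrix $B$ with $d$ columns. With $M$ and $N$ the trace functionals defined in the context, the following hold. For $q=1$ and non-negative integers $k,m$, $$M(1;k\mid m)=N(1;k\mid m)=2\operatorname{Tr}(\mathbf S^{k+m})+\operatorname{Tr}(\mathbf S^k)\operatorname{Tr}(\mathbf S^m).$$ For every integer $q\ge1$ and all non-negative integers $k_1,\dots,k_{q+1},m_1,\dots,m_{q+1}$, $$M(q+1;k_1,\dots,k_q,k_{q+1}\mid m_1,\dots,m_q,m_{q+1})=M(q;k_1,\dots,k_{q-1},k_q+k_{q+1}\mid m_1,\dots,m_{q-1},m_q+m_{q+1})$$ $$+N(q;k_1,\dots,k_{q-1},k_q+m_q\mid m_{q-1},\dots,m_1,k_{q+1}+m_{q+1})+M(q;k_1,\dots,k_{q-1},k_q+m_{q+1}\mid m_1,\dots,m_{q-1},m_q+k_{q+1}),$$ and $$N(q+1;k_1,\dots,k_q,k_{q+1}\mid m_{q+1},m_q,\dots,m_1)=2\,N(q;k_1,\dots,k_{q-1},k_q+k_{q+1}+m_{q+1}\mid m_q,\dots,m_1)$$ $$+\operatorname{Tr}(\mathbf S^{k_{q+1}})\,N(q;k_1,\dots,k_{q-1},k_q+m_{q+1}\mid m_q,\dots,m_1).$$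
   Context: Let $X_1,X_2,\dots$ be i.i.d. $d$-variate standard Gaussian (column) vectors. For $q\ge1$ and non-negative integers $k_1,\dots,k_q,m_1,\dots,m_q$, $$M(q;k_1,\dots,k_q\mid m_1,\dots,m_q)=\mathbb E\Big[\operatorname{Tr}\Big(\prod_{i=1}^q\big(X_iX_i^\top\mathbf S^{k_i}\big)\prod_{i=1}^q\big(X_iX_i^\top\mathbf S^{m_i}\big)\Big)\Big],$$ $$N(q;k_1,\dots,k_q\mid m_q,m_{q-1},\dots,m_1)=\mathbb E\Big[\operatorname{Tr}\Big(\prod_{i=1}^q\big(X_iX_i^\top\mathbf S^{k_i}\big)\prod_{i=1}^q\big(X_{q+1-i}X_{q+1-i}^\top\mathbf S^{m_{q+1-i}}\big)\Big)\Big].$$ Products are ordered left to right in increasing $i$, and $\mathbf S^0=I_d$. Thus the second argument list of $N$, read left to right, gives the exponents of $\mathbf S$ following $X_qX_q^\top,X_{q-1}X_{q-1}^\top,\dots,X_1X_1^\top$ in the second product. Lists such as $k_1,\dots,k_{q-1}$ or $m_{q-1},\dots,m_1$ are empty when $q=1$. *)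

theory Defs
  imports "HOL-Probability.Probability"
begin

text \<open>
  \<^term>\<open>X\<close> models the sequence X 1, X 2, ... of i.i.d. standard Gaussian vectors; the value
  \<^term>\<open>X 0\<close> is unconstrained and never used. The density of a \<open>d\<close>-variate standard Gaussian
  vector is the product of \<open>d\<close> univariate standard normal densities.
\<close>

definition iid_std_gaussian :: "'a measure \<Rightarrow> (nat \<Rightarrow> 'a \<Rightarrow> real^'d) \<Rightarrow> bool" where
  "iid_std_gaussian P X \<longleftrightarrow>
     prob_space P \<and>
     prob_space.indep_vars P (\<lambda>_. borel) X {1..} \<and>
     (\<forall>n\<ge>1. distributed P lborel (X n) (\<lambda>x. ennreal (\<Prod>i\<in>UNIV. std_normal_density (x $ i))))"

text \<open>The class operations \<open>*\<close>, \<open>1\<close> and \<open>^\<close> on the vector type act componentwise, so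
  matrix powers and products of lists of matrices need their own definitions.\<close>

primrec mat_pow :: "real^'d^'d \<Rightarrow> nat \<Rightarrow> real^'d^'d" where
  "mat_pow A 0 = mat 1"
| "mat_pow A (Suc n) = A ** mat_pow A n"

definition mat_prod_list :: "(real^'d^'d) list \<Rightarrow> real^'d^'d" where
  "mat_prod_list As = foldr (**) As (mat 1)"

text \<open>The library leaves the number of columns of \<^const>\<open>columnvector\<close> (and of rows of
  \<^const>\<open>rowvector\<close>) polymorphic; the type annotation makes this the genuine outer product.\<close>

definition outer_square :: "real^'d \<Rightarrow> real^'d^'d" where
  "outer_square x = (columnvector x :: real^1^'d) ** rowvector x"

text \<open>Exponent lists are written exactly as in the mathematical notation, so they have length
  \<^term>\<open>q\<close> and the \<open>i\<close>-th entry, for \<open>i = 1, ..., q\<close>, is at list position \<open>i - 1\<close>.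
  In \<open>N_trace\<close>, the \<open>i\<close>-th entry of the second list is the exponent
  following the factor with index \<open>q + 1 - i\<close>.\<close>

definition M_trace ::
  "'a measure \<Rightarrow> (nat \<Rightarrow> 'a \<Rightarrow> real^'d) \<Rightarrow> real^'d^'d \<Rightarrow> nat \<Rightarrow> nat list \<Rightarrow> nat list \<Rightarrow> real" where
  "M_trace P X S q ks ms =
     (LINT \<omega>|P. trace (
        mat_prod_list (map (\<lambda>i. outer_square (X i \<omega>) ** mat_pow S (ks ! (i - 1))) [1..<Suc q]) **
        mat_prod_list (map (\<lambda>i. outer_square (X i \<omega>) ** mat_pow S (ms ! (i - 1))) [1..<Suc q])))"

definition N_trace ::
  "'a measure \<Rightarrow> (nat \<Rightarrow> 'a \<Rightarrow> real^'d) \<Rightarrow> real^'d^'d \<Rightarrow> nat \<Rightarrow> nat list \<Rightarrow> nat list \<Rightarrow> real" where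
  "N_trace P X S q ks ms =
     (LINT \<omega>|P. trace (
        mat_prod_list (map (\<lambda>i. outer_square (X i \<omega>) ** mat_pow S (ks ! (i - 1))) [1..<Suc q]) **
        mat_prod_list (map (\<lambda>i. outer_square (X (q + 1 - i) \<omega>) ** mat_pow S (ms ! (i - 1))) [1..<Suc q])))"

end

theory Submission
  imports Defs
begin

text \<open>
  Integrate out the last vector \<open>x = X\<^bsub>q+1\<^esub>\<close>, which is independent of the others. It occurs only
  in a block \<open>x x\<^sup>T K x x\<^sup>T\<close>, where \<open>K\<close> depends on the other vectors, and the pairing formula for
  fourth Gaussian moments gives \<open>E (x x\<^sup>T K x x\<^sup>T) = K + K\<^sup>T + Tr(K) I\<close>. For \<open>M\<close> these three summands
  yield the three terms of the recursion: transposing \<open>K\<close> reverses the order of its rank-one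
  factors and so produces \<open>N\<close>, while the product of the two traces in the last term merges into
  one trace because both words start with the same \<open>X\<^sub>1 X\<^sub>1\<^sup>T\<close>. For \<open>N\<close> the block has
  \<open>K = S\<^sup>k\<close>, which is symmetric.
\<close>

section \<open>Moments of a single standard Gaussian vector\<close>

lemma prod_Basis_cart: "(\<Prod>b\<in>(Basis::(real^'d) set). f b) = (\<Prod>j\<in>UNIV. f (axis j (1::real)))"
proof -
  have B: "(Basis::(real^'d) set) = range (\<lambda>j. axis j 1)"
    by (auto simp: Basis_vec_def)
  have inj: "inj (\<lambda>j::'d. axis j (1::real))"
    by (auto simp: inj_on_def axis_eq_axis)
  show ?thesis
    unfolding B by (simp add: prod.reindex[OF inj])
qed

text \<open>Lebesgue measure on vectors is the image of a product measure over \<open>Basis\<close>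
  under the map from coordinates to vectors, so Fubini for finite products applies after a change of
  variables.\<close>

lemma lborel_prod_components:
  fixes f :: "'d::finite \<Rightarrow> real \<Rightarrow> real"
  assumes f: "\<And>j. integrable lborel (f j)"
  shows "integrable lborel (\<lambda>x::real^'d. \<Prod>j\<in>UNIV. f j (x $ j))"
    and "(\<integral>x. (\<Prod>j\<in>UNIV. f j (x $ j)) \<partial>(lborel :: (real^'d) measure)) = (\<Prod>j\<in>UNIV. \<integral>t. f j t \<partial>lborel)"
proof -
  interpret product_sigma_finite "\<lambda>b::real^'d. lborel :: real measure"
    by standard
  \<comment> \<open>The product measure is indexed by basis vectors instead of \<open>'d\<close>;
    \<open>g\<close> relabels the factors accordingly.\<close>
  define g where "g b = f (axis_index b)" for b :: "real^'d"
  have g_axis: "g (axis j 1) = f j" for j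
    by (simp add: g_def)
  have g: "integrable lborel (g b)" if "b \<in> Basis" for b
    using f by (simp add: g_def)
  have meas [measurable]: "f j \<in> borel_measurable borel" for j
    using borel_measurable_integrable[OF f] by simp
  have eq: "(\<Prod>j\<in>UNIV. f j ((\<Sum>b\<in>Basis. y b *\<^sub>R b) $ j)) = (\<Prod>b\<in>Basis. g b (y b))" for y :: "real^'d \<Rightarrow> real"
  proof -
    have "(\<Sum>b\<in>Basis. y b *\<^sub>R b) $ j = y (axis j 1)" for j
      by (subst cart_eq_inner_axis) (simp add: inner_sum_left inner_Basis Basis_vec_def axis_eq_axis if_distrib sum.delta cong: if_cong)
    then show ?thesis
      by (simp add: prod_Basis_cart g_axis)
  qed
  have F: "(\<lambda>x::real^'d. \<Prod>j\<in>UNIV. f j (x $ j)) \<in> borel_measurable borel"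
    by measurable
  have T: "(\<lambda>y. \<Sum>b\<in>Basis. y b *\<^sub>R b) \<in> measurable (\<Pi>\<^sub>M b\<in>Basis. lborel) (borel :: (real^'d) measure)"
    by measurable
  show "integrable lborel (\<lambda>x::real^'d. \<Prod>j\<in>UNIV. f j (x $ j))"
    unfolding lborel_eq[where 'a="real^'d"] integrable_distr_eq[OF T F] eq
    by (rule product_integrable_prod) (auto intro: g)
  show "(\<integral>x. (\<Prod>j\<in>UNIV. f j (x $ j)) \<partial>(lborel :: (real^'d) measure)) = (\<Prod>j\<in>UNIV. \<integral>t. f j t \<partial>lborel)"
    unfolding lborel_eq[where 'a="real^'d"] integral_distr[OF T F] eq
    by (subst product_integral_prod) (auto intro: g simp: prod_Basis_cart g_axis)
qed

text \<open>The Gaussian density splits over the coordinates, so each univariate density can be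
  absorbed into its factor \<open>h j\<close>. This is how independence of the components
  enters.\<close>

lemma std_gaussian_prod_components:
  fixes Y :: "'a \<Rightarrow> real^'d" and h :: "'d \<Rightarrow> real \<Rightarrow> real"
  assumes Y: "distributed P lborel Y (\<lambda>x. ennreal (\<Prod>j\<in>UNIV. std_normal_density (x $ j)))"
    and h: "\<And>j. integrable lborel (\<lambda>t. std_normal_density t * h j t)"
    and meas [measurable]: "\<And>j. h j \<in> borel_measurable borel"
  shows "integrable P (\<lambda>\<omega>. \<Prod>j\<in>UNIV. h j (Y \<omega> $ j))"
    and "(\<integral>\<omega>. (\<Prod>j\<in>UNIV. h j (Y \<omega> $ j)) \<partial>P) = (\<Prod>j\<in>UNIV. \<integral>t. std_normal_density t * h j t \<partial>lborel)"
proof -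
  have F: "(\<lambda>x::real^'d. \<Prod>j\<in>UNIV. h j (x $ j)) \<in> borel_measurable lborel"
    by measurable
  have nn: "0 \<le> (\<Prod>j\<in>UNIV. std_normal_density (x $ j))" for x :: "real^'d"
    by (simp add: prod_nonneg)
  note c = lborel_prod_components[where f = "\<lambda>j t. std_normal_density t * h j t", OF h]
  show "integrable P (\<lambda>\<omega>. \<Prod>j\<in>UNIV. h j (Y \<omega> $ j))"
    using c(1) distributed_integrable[OF Y F nn] by (simp add: prod.distrib)
  show "(\<integral>\<omega>. (\<Prod>j\<in>UNIV. h j (Y \<omega> $ j)) \<partial>P) = (\<Prod>j\<in>UNIV. \<integral>t. std_normal_density t * h j t \<partial>lborel)"
    using c(2) distributed_integral[OF Y F nn] by (simp add: prod.distrib)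
qed

lemma std_gaussian_component_moment:
  fixes Y :: "'a \<Rightarrow> real^'d"
  assumes Y: "distributed P lborel Y (\<lambda>x. ennreal (\<Prod>j\<in>UNIV. std_normal_density (x $ j)))"
  shows "integrable P (\<lambda>\<omega>. \<bar>Y \<omega> $ a\<bar> ^ p)"
proof -
  \<comment> \<open>Factors 1 at all coordinates other than \<open>a\<close> isolate the moment of
    coordinate \<open>a\<close>; for them the moment of order 0, integrability of the density
    itself, is needed.\<close>
  have "integrable lborel (\<lambda>t. std_normal_density t * (if j = a then \<bar>t\<bar> ^ p else 1))" for j
    using integrable_std_normal_moment_abs[of p] integrable_std_normal_moment[of 0] by (cases "j = a") simp_all
  from std_gaussian_prod_components(1)[OF Y, where h = "\<lambda>j t. if j = a then \<bar>t\<bar> ^ p else 1", OF this]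
  show ?thesis by (simp add: if_distribR prod.delta)
qed

text \<open>Isserlis' formula in degree four. Grouping equal coordinates turns the expectation into
  a product of univariate moments, which are 1, 0, 1, 0, 3 for orders 0 to 4; it vanishes unless the
  indices can be paired off.\<close>

lemma std_gaussian_fourth_moment:
  fixes Y :: "'a \<Rightarrow> real^'d"
  assumes Y: "distributed P lborel Y (\<lambda>x. ennreal (\<Prod>j\<in>UNIV. std_normal_density (x $ j)))"
  shows "(\<integral>\<omega>. Y \<omega> $ a * Y \<omega> $ b * Y \<omega> $ c * Y \<omega> $ e \<partial>P) =
    of_bool (a = b) * of_bool (c = e) + of_bool (a = c) * of_bool (b = e) + of_bool (a = e) * of_bool (b = c)"
proof -
  \<comment> \<open>The exponent of coordinate \<open>j\<close> in the monomial.\<close>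
  define n :: "'d \<Rightarrow> nat" where
    "n j = of_bool (j = a) + of_bool (j = b) + of_bool (j = c) + of_bool (j = e)" for j
  define \<mu> :: "nat \<Rightarrow> real" where "\<mu> p = (\<integral>t. std_normal_density t * t ^ p \<partial>lborel)" for p
  have "\<mu> 0 = 1" "\<mu> (Suc 0) = 0" "\<mu> 2 = 1" "\<mu> 3 = 0" "\<mu> 4 = 3"
    using integral_std_normal_moment_even[of 0] integral_std_normal_moment_even[of 1] integral_std_normal_moment_even[of 2]
      integral_std_normal_moment_odd[of 0] integral_std_normal_moment_odd[of 1]
    by (simp_all add: \<mu>_def fact_numeral power2_eq_square)
  \<comment> \<open>Successor form is what the simplifier produces when it adds up the four
    indicators in \<open>n\<close>.\<close>
  then have \<mu>: "\<mu> 0 = 1" "\<mu> (Suc 0) = 0" "\<mu> (Suc (Suc 0)) = 1" "\<mu> (Suc (Suc (Suc 0))) = 0"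
      "\<mu> (Suc (Suc (Suc (Suc 0)))) = 3"
    by (simp_all add: eval_nat_numeral)
  have power_delta: "(\<Prod>j\<in>UNIV. (y $ j) ^ of_bool (j = a)) = y $ a" for y :: "real^'d" and a
  proof -
    have "(\<Prod>j\<in>UNIV. (y $ j) ^ of_bool (j = a)) = (\<Prod>j\<in>UNIV. if j = a then y $ j else 1)"
      by (intro prod.cong) auto
    then show ?thesis by simp
  qed
  have "(\<integral>\<omega>. Y \<omega> $ a * Y \<omega> $ b * Y \<omega> $ c * Y \<omega> $ e \<partial>P) = (\<integral>\<omega>. (\<Prod>j\<in>UNIV. (Y \<omega> $ j) ^ n j) \<partial>P)"
    by (simp add: n_def power_add prod.distrib power_delta)
  also have "\<dots> = (\<Prod>j\<in>UNIV. \<mu> (n j))"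
    unfolding \<mu>_def by (rule std_gaussian_prod_components(2)[OF Y integrable_std_normal_moment]) simp
  \<comment> \<open>All other coordinates have exponent 0 and contribute the factor
    \<open>\<mu> 0 = 1\<close>.\<close>
  also have "\<dots> = (\<Prod>j\<in>{a, b, c, e}. \<mu> (n j))"
    by (rule prod.mono_neutral_right) (auto simp: n_def \<mu>)
  \<comment> \<open>The six comparisons fix the pattern of coincidences; if all four indices agree,
    the moment 3 matches the three pairings.\<close>
  also have "\<dots> = of_bool (a = b) * of_bool (c = e) + of_bool (a = c) * of_bool (b = e) + of_bool (a = e) * of_bool (b = c)"
    by (cases "a = b"; cases "a = c"; cases "a = e"; cases "b = c"; cases "b = e"; cases "c = e"; hypsubst?)
      (simp_all add: n_def \<mu> insert_commute)
  finally show ?thesis .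
qed

section \<open>Polynomials in the coordinates of the vectors: integrability and independence\<close>

inductive poly_in :: "nat set \<Rightarrow> ((nat \<Rightarrow> real^'d) \<Rightarrow> real) \<Rightarrow> bool" for I where
  const: "poly_in I (\<lambda>x. c)"
| coord: "i \<in> I \<Longrightarrow> poly_in I (\<lambda>x. x i $ j)"
| add: "poly_in I f \<Longrightarrow> poly_in I g \<Longrightarrow> poly_in I (\<lambda>x. f x + g x)"
| mult: "poly_in I f \<Longrightarrow> poly_in I g \<Longrightarrow> poly_in I (\<lambda>x. f x * g x)"

lemma poly_in_mono: "poly_in I f \<Longrightarrow> I \<subseteq> J \<Longrightarrow> poly_in J f"
  by (induction rule: poly_in.induct) (auto intro: poly_in.intros)

lemma poly_in_sum: "finite A \<Longrightarrow> (\<And>a. a \<in> A \<Longrightarrow> poly_in I (f a)) \<Longrightarrow> poly_in I (\<lambda>x. \<Sum>a\<in>A. f a x)"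
  by (induction A rule: finite_induct) (auto intro: poly_in.intros)

text \<open>The index set bounds the vectors on which \<open>f\<close> may depend, so
  \<open>f\<close> is really a function on the product space over \<open>I\<close>, the form in
  which independence of subfamilies is stated.\<close>

lemma poly_in_restrict: "poly_in I f \<Longrightarrow> f (restrict x I) = f x"
  by (induction rule: poly_in.induct) auto

lemma borel_measurable_vec_component: "(\<lambda>x::real^'d. x $ j) \<in> borel_measurable borel"
  by measurable

lemma poly_in_measurable: "poly_in I f \<Longrightarrow> f \<in> borel_measurable (\<Pi>\<^sub>M i\<in>I. borel)"
proof (induction rule: poly_in.induct)
  case (coord i j)
  then have "(\<lambda>x. x i) \<in> measurable (\<Pi>\<^sub>M i\<in>I. borel) (borel :: (real^'a) measure)"
    by (rule measurable_component_singleton)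
  then show ?case
    by (rule measurable_compose[OF _ borel_measurable_vec_component])
qed auto

locale std_gaussian_sequence =
  fixes P :: "'a measure" and X :: "nat \<Rightarrow> 'a \<Rightarrow> real^'d"
  assumes iid: "iid_std_gaussian P X"
begin

sublocale prob_space P
  using iid by (simp add: iid_std_gaussian_def)

lemma indep: "indep_vars (\<lambda>_. borel) X {1..}"
  using iid by (simp add: iid_std_gaussian_def)

lemma dist: "1 \<le> n \<Longrightarrow> distributed P lborel (X n) (\<lambda>x. ennreal (\<Prod>i\<in>UNIV. std_normal_density (x $ i)))"
  using iid by (simp add: iid_std_gaussian_def)

lemma X_measurable: "1 \<le> n \<Longrightarrow> X n \<in> borel_measurable P"
  using distributed_measurable[OF dist] by simp

lemma poly_in_random_variable:
  assumes "poly_in {1..} f"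
  shows "(\<lambda>\<omega>. f (\<lambda>i. X i \<omega>)) \<in> borel_measurable P"
  using assms
proof (induction rule: poly_in.induct)
  case (coord i j)
  then have "X i \<in> borel_measurable P"
    by (intro X_measurable) simp
  then show ?case
    by (rule measurable_compose[OF _ borel_measurable_vec_component])
qed auto

text \<open>Integrability alone is not preserved by products, so the induction carries all absolute
  moments: a product has a moment of order \<open>p\<close> because its factors have moments of
  order \<open>2 * p\<close>.\<close>

lemma poly_in_moments:
  assumes "poly_in {1..} f"
  shows "integrable P (\<lambda>\<omega>. \<bar>f (\<lambda>i. X i \<omega>)\<bar> ^ p)"
  using assms
proof (induction arbitrary: p rule: poly_in.induct)
  case (const c)
  show ?case by simp
next
  case (coord i j)
  then show ?case by (intro std_gaussian_component_moment dist) simp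
next
  case (add f g)
  note [measurable] = add.hyps[THEN poly_in_random_variable]
  \<comment> \<open>The sum is at most twice the larger summand, and the power of a maximum is at
    most the sum of the powers.\<close>
  have bound: "\<bar>u + v\<bar> ^ p \<le> 2 ^ p * (\<bar>u\<bar> ^ p + \<bar>v\<bar> ^ p)" for u v :: real
  proof -
    have "\<bar>u + v\<bar> ^ p \<le> (2 * max \<bar>u\<bar> \<bar>v\<bar>) ^ p"
      by (rule power_mono) linarith+
    also have "\<dots> = 2 ^ p * max \<bar>u\<bar> \<bar>v\<bar> ^ p"
      by (rule power_mult_distrib)
    also have "max \<bar>u\<bar> \<bar>v\<bar> ^ p \<le> \<bar>u\<bar> ^ p + \<bar>v\<bar> ^ p"
      unfolding max_def by (simp del: power_abs)
    finally show ?thesis by simp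
  qed
  show ?case
  proof (rule Bochner_Integration.integrable_bound)
    show "integrable P (\<lambda>\<omega>. 2 ^ p * (\<bar>f (\<lambda>i. X i \<omega>)\<bar> ^ p + \<bar>g (\<lambda>i. X i \<omega>)\<bar> ^ p))"
      by (intro integrable_mult_right Bochner_Integration.integrable_add add.IH)
    show "AE \<omega> in P. norm (\<bar>f (\<lambda>i. X i \<omega>) + g (\<lambda>i. X i \<omega>)\<bar> ^ p)
        \<le> norm (2 ^ p * (\<bar>f (\<lambda>i. X i \<omega>)\<bar> ^ p + \<bar>g (\<lambda>i. X i \<omega>)\<bar> ^ p))"
      unfolding real_norm_def abs_of_nonneg[OF zero_le_power[OF abs_ge_zero]]
      by (intro AE_I2 order_trans[OF bound abs_ge_self])
  qed measurable
next
  case (mult f g)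
  note [measurable] = mult.hyps[THEN poly_in_random_variable]
  \<comment> \<open>The inequality between arithmetic and geometric mean for the \<open>p\<close>-th
    powers, with a factor 2 to spare.\<close>
  have bound: "\<bar>u * v\<bar> ^ p \<le> \<bar>u\<bar> ^ (2 * p) + \<bar>v\<bar> ^ (2 * p)" for u v :: real
  proof -
    have "2 * (\<bar>u\<bar> ^ p * \<bar>v\<bar> ^ p) \<le> \<bar>u\<bar> ^ (2 * p) + \<bar>v\<bar> ^ (2 * p)"
      using sum_squares_bound[of "\<bar>u\<bar> ^ p" "\<bar>v\<bar> ^ p"] unfolding power_even_eq by linarith
    moreover have "0 \<le> \<bar>u\<bar> ^ p * \<bar>v\<bar> ^ p"
      by (intro mult_nonneg_nonneg zero_le_power abs_ge_zero)
    ultimately show ?thesis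
      unfolding abs_mult power_mult_distrib by linarith
  qed
  show ?case
  proof (rule Bochner_Integration.integrable_bound)
    show "integrable P (\<lambda>\<omega>. \<bar>f (\<lambda>i. X i \<omega>)\<bar> ^ (2 * p) + \<bar>g (\<lambda>i. X i \<omega>)\<bar> ^ (2 * p))"
      by (intro Bochner_Integration.integrable_add mult.IH)
    show "AE \<omega> in P. norm (\<bar>f (\<lambda>i. X i \<omega>) * g (\<lambda>i. X i \<omega>)\<bar> ^ p)
        \<le> norm (\<bar>f (\<lambda>i. X i \<omega>)\<bar> ^ (2 * p) + \<bar>g (\<lambda>i. X i \<omega>)\<bar> ^ (2 * p))"
      unfolding real_norm_def abs_of_nonneg[OF zero_le_power[OF abs_ge_zero]]
      by (intro AE_I2 order_trans[OF bound abs_ge_self])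
  qed measurable
qed

lemma poly_in_integrable:
  assumes "poly_in {1..} f"
  shows "integrable P (\<lambda>\<omega>. f (\<lambda>i. X i \<omega>))"
  using poly_in_moments[OF assms, of 1] integrable_abs_iff[OF poly_in_random_variable[OF assms]] by simp

text \<open>Disjoint subfamilies of an independent family are independent, and each polynomial is a
  measurable function of its own subfamily.\<close>

lemma poly_in_indep_expectation:
  assumes f: "poly_in I f" and g: "poly_in J g"
    and IJ: "I \<inter> J = {}" "I \<subseteq> {1..}" "J \<subseteq> {1..}"
  shows "expectation (\<lambda>\<omega>. f (\<lambda>i. X i \<omega>) * g (\<lambda>i. X i \<omega>)) =
    expectation (\<lambda>\<omega>. f (\<lambda>i. X i \<omega>)) * expectation (\<lambda>\<omega>. g (\<lambda>i. X i \<omega>))"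
proof -
  have "indep_var borel (f \<circ> (\<lambda>\<omega>. restrict (\<lambda>i. X i \<omega>) I)) borel (g \<circ> (\<lambda>\<omega>. restrict (\<lambda>i. X i \<omega>) J))"
    by (rule indep_var_compose[OF indep_var_restrict[OF indep IJ]])
      (use f g poly_in_measurable in auto)
  then have "indep_var borel (\<lambda>\<omega>. f (\<lambda>i. X i \<omega>)) borel (\<lambda>\<omega>. g (\<lambda>i. X i \<omega>))"
    by (simp add: comp_def poly_in_restrict[OF f] poly_in_restrict[OF g])
  then show ?thesis
    using f g IJ by (intro indep_var_lebesgue_integral poly_in_integrable) (auto intro: poly_in_mono)
qed

end

section \<open>Algebra of rank-one factors and traces\<close>

lemma outer_square_nth: "outer_square y $ i $ j = y $ i * y $ j"
  by (simp add: outer_square_def matrix_matrix_mult_def columnvector_def rowvector_def)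

lemma transpose_outer_square: "transpose (outer_square y) = outer_square y"
  by (simp add: transpose_def outer_square_nth vec_eq_iff mult.commute)

lemma mat_pow_add: "mat_pow S (a + b) = mat_pow S a ** mat_pow S b"
  by (induction a) (simp_all add: matrix_mul_assoc)

lemma transpose_mat_pow:
  assumes "transpose S = S"
  shows "transpose (mat_pow S n) = mat_pow S n"
proof (induction n)
  case (Suc n)
  \<comment> \<open>Transposition leaves the extra \<open>S\<close> on the right; additivity of
    exponents moves it back to the left.\<close>
  have "transpose (mat_pow S (Suc n)) = mat_pow S n ** mat_pow S 1"
    by (simp add: matrix_transpose_mul Suc assms)
  then show ?case
    by (metis mat_pow_add add.commute plus_1_eq_Suc)
qed (simp add: transpose_mat)

lemma trace_mult_nth: "trace (A ** B) = (\<Sum>a\<in>UNIV. \<Sum>b\<in>UNIV. A $ a $ b * B $ b $ a)"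
  by (simp add: trace_def matrix_matrix_mult_def)

lemma outer_square_sandwich_nth:
  "(outer_square y ** K ** outer_square y) $ b $ a =
    (\<Sum>c\<in>UNIV. \<Sum>e\<in>UNIV. K $ c $ e * (y $ a * y $ b * y $ c * y $ e))"
  by (simp add: matrix_matrix_mult_def outer_square_nth sum_distrib_right sum_distrib_left mult_ac)
    (subst sum.swap, simp add: mult_ac)

lemma trace_outer_square_mult: "trace (outer_square y ** K) = (\<Sum>c\<in>UNIV. \<Sum>e\<in>UNIV. K $ c $ e * (y $ c * y $ e))"
  by (simp add: trace_mult_nth outer_square_nth mult_ac) (subst sum.swap, simp add: mult_ac)

lemma scaleR_matrix_mult: "(c *\<^sub>R A) ** B = c *\<^sub>R (A ** B)" for A :: "real^'n^'m"
  by (simp add: vec_eq_iff matrix_matrix_mult_def sum_distrib_left mult.assoc)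

text \<open>The block \<open>y y^T K y y^T\<close> is the scalar \<open>y^T K y\<close> times
  \<open>y y^T\<close>, and this scalar is the trace of \<open>y y^T K\<close>. Hence two traces
  sharing a rank-one factor merge into one.\<close>

lemma trace_outer_square_mult_mult:
  "trace (outer_square y ** K) * trace (outer_square y ** L) =
    trace (outer_square y ** K ** (outer_square y ** L))"
proof -
  have "outer_square y ** K ** outer_square y = trace (outer_square y ** K) *\<^sub>R outer_square y"
    by (simp add: vec_eq_iff outer_square_sandwich_nth trace_outer_square_mult outer_square_nth
        sum_distrib_left mult_ac)
  then have "outer_square y ** K ** (outer_square y ** L) = trace (outer_square y ** K) *\<^sub>R (outer_square y ** L)"
    by (simp add: matrix_mul_assoc scaleR_matrix_mult)
  then show ?thesis
    by (simp add: trace_def sum_distrib_left)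
qed

text \<open>Cyclicity of the trace brings \<open>D\<close> next to \<open>A\<close>. The expansion
  then separates the coefficients from the degree-four monomials in \<open>y\<close>, whose moments
  are known.\<close>

lemma trace_outer_square_sandwich:
  "trace (A ** outer_square y ** K ** outer_square y ** D) =
    (\<Sum>a\<in>UNIV. \<Sum>b\<in>UNIV. \<Sum>c\<in>UNIV. \<Sum>e\<in>UNIV.
      ((D ** A) $ a $ b * K $ c $ e) * (y $ a * y $ b * y $ c * y $ e))"
proof -
  have "trace (A ** outer_square y ** K ** outer_square y ** D) =
      trace (D ** A ** (outer_square y ** K ** outer_square y))"
    by (subst trace_mul_sym) (simp add: matrix_mul_assoc)
  then show ?thesis
    by (simp add: trace_mult_nth outer_square_sandwich_nth sum_distrib_left mult.assoc)
qed

text \<open>Each pairing contracts the indices of \<open>G\<close> and \<open>K\<close> in its own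
  way: \<open>a = b\<close>, \<open>c = e\<close> gives two separate traces, \<open>a = c\<close>,
  \<open>b = e\<close> gives the transpose, and \<open>a = e\<close>, \<open>b = c\<close> the plain
  product.\<close>

lemma sum_pairings:
  fixes G K :: "real^'d^'d"
  shows "(\<Sum>a\<in>UNIV. \<Sum>b\<in>UNIV. \<Sum>c\<in>UNIV. \<Sum>e\<in>UNIV. (G $ a $ b * K $ c $ e) *
      (of_bool (a = b) * of_bool (c = e) + of_bool (a = c) * of_bool (b = e) + of_bool (a = e) * of_bool (b = c))) =
    trace G * trace K + trace (G ** transpose K) + trace (G ** K)"
proof -
  have delta: "(\<Sum>j\<in>UNIV. f j * of_bool (i = j)) = f i" for f :: "'d \<Rightarrow> real" and i
    by (simp add: of_bool_def if_distrib cong: if_cong)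
  have delta': "(\<Sum>j\<in>UNIV. f j * (u * of_bool (i = j))) = f i * u"
      "(\<Sum>j\<in>UNIV. f j * (of_bool (i = j) * u)) = f i * u" for f :: "'d \<Rightarrow> real" and i and u :: real
    using delta[of "\<lambda>j. f j * u"] by (simp_all add: mult_ac)
  show ?thesis
    unfolding distrib_left sum.distrib delta' sum_distrib_right[symmetric] delta
    by (simp add: trace_mult_nth) (simp add: trace_def sum_product transpose_def)
qed

section \<open>Integrating out one Gaussian vector\<close>

definition poly_mat :: "nat set \<Rightarrow> ((nat \<Rightarrow> real^'d) \<Rightarrow> real^'d^'d) \<Rightarrow> bool" where
  "poly_mat I F \<longleftrightarrow> (\<forall>a b. poly_in I (\<lambda>x. F x $ a $ b))"

lemma poly_mat_const: "poly_mat I (\<lambda>x. A)"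
  by (simp add: poly_mat_def poly_in.const)

lemma poly_mat_mult: "poly_mat I F \<Longrightarrow> poly_mat I G \<Longrightarrow> poly_mat I (\<lambda>x. F x ** G x)"
  by (simp add: poly_mat_def matrix_matrix_mult_def poly_in_sum poly_in.mult)

lemma poly_mat_transpose: "poly_mat I F \<Longrightarrow> poly_mat I (\<lambda>x. transpose (F x))"
  by (simp add: poly_mat_def transpose_def)

lemma poly_mat_outer_square: "i \<in> I \<Longrightarrow> poly_mat I (\<lambda>x. outer_square (x i))"
  by (simp add: poly_mat_def outer_square_nth poly_in.mult poly_in.coord)

lemma poly_mat_trace: "poly_mat I F \<Longrightarrow> poly_in I (\<lambda>x. trace (F x))"
  by (simp add: poly_mat_def trace_def poly_in_sum)

text \<open>The coefficients involve only the first \<open>q\<close> vectors, so the monomials in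
  vector \<open>Suc q\<close> may be replaced by their fourth moments. For \<open>q = 0\<close> the
  index set is empty and \<open>A\<close>, \<open>K\<close>, \<open>D\<close> are constant.\<close>

lemma (in std_gaussian_sequence) expectation_outer_square_sandwich:
  fixes A K D :: "(nat \<Rightarrow> real^'d) \<Rightarrow> real^'d^'d"
  assumes A: "poly_mat {1..q} A" and K: "poly_mat {1..q} K" and D: "poly_mat {1..q} D"
  shows "expectation (\<lambda>\<omega>. trace (A (\<lambda>i. X i \<omega>) ** outer_square (X (Suc q) \<omega>) ** K (\<lambda>i. X i \<omega>)
        ** outer_square (X (Suc q) \<omega>) ** D (\<lambda>i. X i \<omega>))) =
      expectation (\<lambda>\<omega>. trace (A (\<lambda>i. X i \<omega>) ** K (\<lambda>i. X i \<omega>) ** D (\<lambda>i. X i \<omega>)))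
    + expectation (\<lambda>\<omega>. trace (A (\<lambda>i. X i \<omega>) ** transpose (K (\<lambda>i. X i \<omega>)) ** D (\<lambda>i. X i \<omega>)))
    + expectation (\<lambda>\<omega>. trace (K (\<lambda>i. X i \<omega>)) * trace (A (\<lambda>i. X i \<omega>) ** D (\<lambda>i. X i \<omega>)))"
proof -
  define G where "G x = D x ** A x" for x
  have G: "poly_mat {1..q} G"
    unfolding G_def by (rule poly_mat_mult[OF D A])
  define f where "f a b c e x = G x $ a $ b * K x $ c $ e" for a b c e x
  define g where "g a b c e x = x (Suc q) $ a * x (Suc q) $ b * x (Suc q) $ c * x (Suc q) $ e" for a b c e and x :: "nat \<Rightarrow> real^'d"
  define \<delta> :: "'d \<Rightarrow> 'd \<Rightarrow> 'd \<Rightarrow> 'd \<Rightarrow> real" where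
    "\<delta> a b c e = of_bool (a = b) * of_bool (c = e) + of_bool (a = c) * of_bool (b = e) + of_bool (a = e) * of_bool (b = c)" for a b c e
  have f: "poly_in {1..q} (f a b c e)" for a b c e
    unfolding f_def using G K by (auto simp: poly_mat_def intro: poly_in.mult)
  have g: "poly_in {Suc q} (g a b c e)" for a b c e
    unfolding g_def by (intro poly_in.mult poly_in.coord) simp_all
  have f_int [simp]: "integrable P (\<lambda>\<omega>. f a b c e (\<lambda>i. X i \<omega>))" for a b c e
    by (rule poly_in_integrable, rule poly_in_mono[OF f]) auto
  have fg_int [simp]: "integrable P (\<lambda>\<omega>. f a b c e (\<lambda>i. X i \<omega>) * g a b c e (\<lambda>i. X i \<omega>))" for a b c e
    by (rule poly_in_integrable, intro poly_in.mult; rule poly_in_mono, rule f g) auto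
  \<comment> \<open>Independence splits off the moment \<open>\<delta> a b c e\<close>; this
    constant then returns under the expectation, so that the pairings can be summed
    pointwise.\<close>
  have fg: "expectation (\<lambda>\<omega>. f a b c e (\<lambda>i. X i \<omega>) * g a b c e (\<lambda>i. X i \<omega>)) =
      expectation (\<lambda>\<omega>. f a b c e (\<lambda>i. X i \<omega>) * \<delta> a b c e)" for a b c e
    using poly_in_indep_expectation[OF f g] std_gaussian_fourth_moment[OF dist[of "Suc q"]]
    by (simp add: g_def \<delta>_def)
  have sandwich: "trace (A (\<lambda>i. X i \<omega>) ** outer_square (X (Suc q) \<omega>) ** K (\<lambda>i. X i \<omega>)
        ** outer_square (X (Suc q) \<omega>) ** D (\<lambda>i. X i \<omega>)) =
      (\<Sum>a\<in>UNIV. \<Sum>b\<in>UNIV. \<Sum>c\<in>UNIV. \<Sum>e\<in>UNIV. f a b c e (\<lambda>i. X i \<omega>) * g a b c e (\<lambda>i. X i \<omega>))" for \<omega>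
    unfolding trace_outer_square_sandwich f_def g_def G_def ..
  have AKD: "poly_mat {1..} A" "poly_mat {1..} K" "poly_mat {1..} D"
    using A K D by (auto simp: poly_mat_def intro: poly_in_mono[of "{1..q}"] simp del: One_nat_def)
  have "expectation (\<lambda>\<omega>. trace (A (\<lambda>i. X i \<omega>) ** outer_square (X (Suc q) \<omega>) ** K (\<lambda>i. X i \<omega>)
        ** outer_square (X (Suc q) \<omega>) ** D (\<lambda>i. X i \<omega>))) =
      (\<Sum>a\<in>UNIV. \<Sum>b\<in>UNIV. \<Sum>c\<in>UNIV. \<Sum>e\<in>UNIV. expectation (\<lambda>\<omega>. f a b c e (\<lambda>i. X i \<omega>) * g a b c e (\<lambda>i. X i \<omega>)))"
    unfolding sandwich by (simp add: Bochner_Integration.integral_sum)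
  also have "\<dots> = expectation (\<lambda>\<omega>. \<Sum>a\<in>UNIV. \<Sum>b\<in>UNIV. \<Sum>c\<in>UNIV. \<Sum>e\<in>UNIV. f a b c e (\<lambda>i. X i \<omega>) * \<delta> a b c e)"
    unfolding fg by (simp add: Bochner_Integration.integral_sum)
  also have "\<dots> = expectation (\<lambda>\<omega>.
        trace (A (\<lambda>i. X i \<omega>) ** K (\<lambda>i. X i \<omega>) ** D (\<lambda>i. X i \<omega>))
      + trace (A (\<lambda>i. X i \<omega>) ** transpose (K (\<lambda>i. X i \<omega>)) ** D (\<lambda>i. X i \<omega>))
      + trace (K (\<lambda>i. X i \<omega>)) * trace (A (\<lambda>i. X i \<omega>) ** D (\<lambda>i. X i \<omega>)))"
  proof (rule Bochner_Integration.integral_cong[OF refl])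
    fix \<omega>
    \<comment> \<open>This undoes the cyclic shift hidden in \<open>G = D ** A\<close>.\<close>
    have rot: "trace (D' ** A' ** L) = trace (A' ** L ** D')" for A' D' L :: "real^'d^'d"
      by (metis matrix_mul_assoc trace_mul_sym)
    show "(\<Sum>a\<in>UNIV. \<Sum>b\<in>UNIV. \<Sum>c\<in>UNIV. \<Sum>e\<in>UNIV. f a b c e (\<lambda>i. X i \<omega>) * \<delta> a b c e) =
        trace (A (\<lambda>i. X i \<omega>) ** K (\<lambda>i. X i \<omega>) ** D (\<lambda>i. X i \<omega>))
      + trace (A (\<lambda>i. X i \<omega>) ** transpose (K (\<lambda>i. X i \<omega>)) ** D (\<lambda>i. X i \<omega>))
      + trace (K (\<lambda>i. X i \<omega>)) * trace (A (\<lambda>i. X i \<omega>) ** D (\<lambda>i. X i \<omega>))"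
      unfolding f_def \<delta>_def sum_pairings G_def
      by (simp add: rot[of _ _ "K _"] rot[of _ _ "transpose _"] trace_mul_sym[of "D (\<lambda>i. X i \<omega>)"])
  qed
  also have "\<dots> = expectation (\<lambda>\<omega>. trace (A (\<lambda>i. X i \<omega>) ** K (\<lambda>i. X i \<omega>) ** D (\<lambda>i. X i \<omega>)))
    + expectation (\<lambda>\<omega>. trace (A (\<lambda>i. X i \<omega>) ** transpose (K (\<lambda>i. X i \<omega>)) ** D (\<lambda>i. X i \<omega>)))
    + expectation (\<lambda>\<omega>. trace (K (\<lambda>i. X i \<omega>)) * trace (A (\<lambda>i. X i \<omega>) ** D (\<lambda>i. X i \<omega>)))"
  proof -
    have "integrable P (\<lambda>\<omega>. trace (A (\<lambda>i. X i \<omega>) ** K (\<lambda>i. X i \<omega>) ** D (\<lambda>i. X i \<omega>)))"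
      by (rule poly_in_integrable) (intro poly_mat_trace poly_mat_mult AKD)
    moreover have "integrable P (\<lambda>\<omega>. trace (A (\<lambda>i. X i \<omega>) ** transpose (K (\<lambda>i. X i \<omega>)) ** D (\<lambda>i. X i \<omega>)))"
      by (rule poly_in_integrable) (intro poly_mat_trace poly_mat_mult poly_mat_transpose AKD)
    moreover have "integrable P (\<lambda>\<omega>. trace (K (\<lambda>i. X i \<omega>)) * trace (A (\<lambda>i. X i \<omega>) ** D (\<lambda>i. X i \<omega>)))"
      by (rule poly_in_integrable) (intro poly_in.mult poly_mat_trace poly_mat_mult AKD)
    ultimately show ?thesis by simp
  qed
  finally show ?thesis .
qed

section \<open>Words in rank-one factors and powers of \<open>S\<close>\<close>

definition word :: "real^'d^'d \<Rightarrow> (nat \<times> nat) list \<Rightarrow> (nat \<Rightarrow> real^'d) \<Rightarrow> real^'d^'d" where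
  "word S l x = mat_prod_list (map (\<lambda>(i, k). outer_square (x i) ** mat_pow S k) l)"

lemma word_Nil [simp]: "word S [] x = mat 1"
  by (simp add: word_def mat_prod_list_def)

lemma word_Cons: "word S ((i, k) # l) x = outer_square (x i) ** mat_pow S k ** word S l x"
  by (simp add: word_def mat_prod_list_def)

lemma word_append: "word S (l @ l') x = word S l x ** word S l' x"
  by (induction l) (auto simp: word_Cons matrix_mul_assoc)

lemma word_snoc: "word S (l @ [(i, k)]) x = word S l x ** outer_square (x i) ** mat_pow S k"
  by (simp add: word_append word_Cons matrix_mul_assoc)

lemma word_snoc_mat_pow: "word S (l @ [(i, k)]) x ** mat_pow S k' = word S (l @ [(i, k + k')]) x"
  by (simp add: word_snoc mat_pow_add matrix_mul_assoc)

lemma poly_mat_word: "fst ` set l \<subseteq> I \<Longrightarrow> poly_mat I (word S l)"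
proof (induction l)
  case Nil
  then show ?case by (simp add: word_def poly_mat_const)
next
  case (Cons p l)
  then show ?case
    by (cases p) (auto simp: word_Cons[abs_def] intro!: poly_mat_mult poly_mat_outer_square poly_mat_const)
qed

text \<open>After reversal each power of \<open>S\<close> stands before its own rank-one factor,
  hence after the factor to its left. Indices and exponents are thus shifted by one against each
  other; \<open>j\<close> supplies the missing first index and \<open>r\<close> the missing last
  exponent. In the induction the last index of the word becomes the next \<open>j\<close>.\<close>

lemma transpose_word:
  assumes "transpose S = S"
  shows "outer_square (x j) ** transpose (word S l x) ** mat_pow S r =
    word S (zip (j # rev (map fst l)) (rev (map snd l) @ [r])) x"
proof (induction l arbitrary: j rule: rev_induct)
  case Nil
  then show ?case by (simp add: word_Cons transpose_mat)
next
  case (snoc p l)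
  obtain i k where p: "p = (i, k)" by fastforce
  show ?case
    using snoc[of i]
    by (simp add: p word_snoc word_Cons matrix_transpose_mul transpose_outer_square
        transpose_mat_pow[OF assms] matrix_mul_assoc[symmetric])
qed

lemma trace_word_mult:
  assumes "l \<noteq> []" "l' \<noteq> []" "fst (hd l) = fst (hd l')"
  shows "trace (word S l x) * trace (word S l' x) = trace (word S l x ** word S l' x)"
proof -
  obtain i k u k' u' where "l = (i, k) # u" "l' = (i, k') # u'"
    using assms by (cases l; cases l') auto
  then show ?thesis
    using trace_outer_square_mult_mult[of "x i" "mat_pow S k ** word S u x" "mat_pow S k' ** word S u' x"]
    by (simp add: word_Cons matrix_mul_assoc)
qed

lemma word_zip_upt:
  "length ks = q \<Longrightarrow> word S (zip [1..<Suc q] ks) x =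
    mat_prod_list (map (\<lambda>i. outer_square (x i) ** mat_pow S (ks ! (i - 1))) [1..<Suc q])"
  unfolding word_def by (intro arg_cong[where f = mat_prod_list] nth_equalityI) (simp_all del: upt_Suc)

text \<open>The descending range carries the index \<open>q + 1 - i\<close> at position
  \<open>i - 1\<close>, as in the second product of \<open>N_trace\<close>.\<close>

lemma word_zip_rev_upt:
  "length ks = q \<Longrightarrow> word S (zip (rev [1..<Suc q]) ks) x =
    mat_prod_list (map (\<lambda>i. outer_square (x (q + 1 - i)) ** mat_pow S (ks ! (i - 1))) [1..<Suc q])"
  unfolding word_def
  by (intro arg_cong[where f = mat_prod_list] nth_equalityI) (simp_all add: rev_nth Suc_diff_Suc del: upt_Suc)

lemma M_trace_word:
  assumes "length ks = q" "length ms = q"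
  shows "M_trace P X S q ks ms =
    (LINT \<omega>|P. trace (word S (zip [1..<Suc q] ks) (\<lambda>i. X i \<omega>) ** word S (zip [1..<Suc q] ms) (\<lambda>i. X i \<omega>)))"
  unfolding M_trace_def word_zip_upt[OF assms(1)] word_zip_upt[OF assms(2)] ..

lemma N_trace_word:
  assumes "length ks = q" "length ms = q"
  shows "N_trace P X S q ks ms =
    (LINT \<omega>|P. trace (word S (zip [1..<Suc q] ks) (\<lambda>i. X i \<omega>) ** word S (zip (rev [1..<Suc q]) ms) (\<lambda>i. X i \<omega>)))"
  unfolding N_trace_def word_zip_upt[OF assms(1)] word_zip_rev_upt[OF assms(2)] ..

lemma zip_map_self: "zip xs (map f xs) = map (\<lambda>x. (x, f x)) xs"
  by (simp add: zip_map2 zip_same_conv_map)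

text \<open>Exposes the prefix of pairs common to all terms of a recursion, in which only the last
  exponents differ.\<close>

lemma zip_upt_snoc:
  assumes "1 \<le> q"
  shows "zip [1..<Suc q] (map k [1..<q] @ [a]) = map (\<lambda>i. (i, k i)) [1..<q] @ [(q, a)]"
  using assms by (simp add: zip_map_self)

lemma zip_upt_snoc2:
  assumes "1 \<le> q"
  shows "zip [1..<Suc (q + 1)] (map k [1..<q] @ [a, b]) =
    map (\<lambda>i. (i, k i)) [1..<q] @ [(q, a), (Suc q, b)]"
  using assms by (simp add: zip_map_self)

section \<open>The case \<open>q = 1\<close> and the two recursions\<close>

context std_gaussian_sequence
begin

lemma M_trace_1: "M_trace P X S 1 [k] [m] = 2 * trace (mat_pow S (k + m)) + trace (mat_pow S k) * trace (mat_pow S m)"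
  if sym: "transpose S = S"
proof -
  have "M_trace P X S 1 [k] [m] =
      expectation (\<lambda>\<omega>. trace (mat 1 ** outer_square (X (Suc 0) \<omega>) ** mat_pow S k ** outer_square (X (Suc 0) \<omega>) ** mat_pow S m))"
    by (simp add: M_trace_word word_Cons matrix_mul_assoc)
  also have "\<dots> = 2 * trace (mat_pow S (k + m)) + trace (mat_pow S k) * trace (mat_pow S m)"
    \<comment> \<open>No earlier vectors are present, so everything around the block is constant;
      \<open>mat_pow S k\<close> equals its transpose, which gives the factor 2.\<close>
    by (subst expectation_outer_square_sandwich[where q = 0 and A = "\<lambda>_. mat 1" and K = "\<lambda>_. mat_pow S k" and D = "\<lambda>_. mat_pow S m"])
      (simp_all add: poly_mat_const transpose_mat_pow[OF sym] mat_pow_add prob_space)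
  finally show ?thesis .
qed

lemma M_trace_Suc:
  assumes sym: "transpose S = S" and q: "1 \<le> q"
  shows "M_trace P X S (q + 1) (map k [1..<q] @ [k q, k (q + 1)]) (map m [1..<q] @ [m q, m (q + 1)]) =
      M_trace P X S q (map k [1..<q] @ [k q + k (q + 1)]) (map m [1..<q] @ [m q + m (q + 1)])
    + N_trace P X S q (map k [1..<q] @ [k q + m q]) (map m (rev [1..<q]) @ [k (q + 1) + m (q + 1)])
    + M_trace P X S q (map k [1..<q] @ [k q + m (q + 1)]) (map m [1..<q] @ [m q + k (q + 1)])"
proof -
  define u where "u = map (\<lambda>i. (i, k i)) [1..<q]"
  define v where "v = map (\<lambda>i. (i, m i)) [1..<q]"
  let ?x = "\<lambda>\<omega> i. X i \<omega>"
  let ?k = "k (q + 1)" and ?m = "m (q + 1)"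
  define A where "A = word S (u @ [(q, k q)])"
  define C where "C = word S (v @ [(q, m q)])"
  have uv: "fst ` set (u @ [(q, k q)]) \<subseteq> {1..q}" "fst ` set (v @ [(q, m q)]) \<subseteq> {1..q}"
    using q by (auto simp: u_def v_def)
  have polys: "poly_mat {1..q} A" "poly_mat {1..q} (\<lambda>x. mat_pow S ?k ** C x)"
    unfolding A_def C_def by (intro poly_mat_mult poly_mat_const poly_mat_word uv)+
  have "M_trace P X S (q + 1) (map k [1..<q] @ [k q, ?k]) (map m [1..<q] @ [m q, ?m]) =
      expectation (\<lambda>\<omega>. trace (word S (u @ [(q, k q), (Suc q, ?k)]) (?x \<omega>) ** word S (v @ [(q, m q), (Suc q, ?m)]) (?x \<omega>)))"
    unfolding u_def v_def zip_upt_snoc2[OF q, symmetric] by (rule M_trace_word) (use q in simp_all)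
  \<comment> \<open>Cut at the two occurrences of \<open>X (Suc q)\<close>: the enclosed block is
    \<open>mat_pow S ?k ** C\<close>, and \<open>mat_pow S ?m\<close> is the tail.\<close>
  also have "\<dots> = expectation (\<lambda>\<omega>. trace (A (?x \<omega>) ** outer_square (X (Suc q) \<omega>) ** (mat_pow S ?k ** C (?x \<omega>))
      ** outer_square (X (Suc q) \<omega>) ** mat_pow S ?m))"
    by (simp add: A_def C_def word_append word_Cons matrix_mul_assoc)
  also have "\<dots> =
      expectation (\<lambda>\<omega>. trace (A (?x \<omega>) ** (mat_pow S ?k ** C (?x \<omega>)) ** mat_pow S ?m))
    + expectation (\<lambda>\<omega>. trace (A (?x \<omega>) ** transpose (mat_pow S ?k ** C (?x \<omega>)) ** mat_pow S ?m))
    + expectation (\<lambda>\<omega>. trace (mat_pow S ?k ** C (?x \<omega>)) * trace (A (?x \<omega>) ** mat_pow S ?m))"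
    by (rule expectation_outer_square_sandwich[OF polys poly_mat_const])
  \<comment> \<open>First summand: the two powers of \<open>S\<close> merge into the last exponents
    of \<open>A\<close> and \<open>C\<close>.\<close>
  also have "expectation (\<lambda>\<omega>. trace (A (?x \<omega>) ** (mat_pow S ?k ** C (?x \<omega>)) ** mat_pow S ?m)) =
      expectation (\<lambda>\<omega>. trace (word S (u @ [(q, k q + ?k)]) (?x \<omega>) ** word S (v @ [(q, m q + ?m)]) (?x \<omega>)))"
    unfolding A_def C_def word_snoc_mat_pow[symmetric] by (simp only: matrix_mul_assoc)
  also have "\<dots> = M_trace P X S q (map k [1..<q] @ [k q + ?k]) (map m [1..<q] @ [m q + ?m])"
    unfolding u_def v_def zip_upt_snoc[OF q, symmetric] by (rule M_trace_word[symmetric]) (use q in simp_all)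
  \<comment> \<open>Second summand: the transposed block starts with the power \<open>m q\<close>,
    which joins the last exponent of \<open>A\<close>, and ends with the power \<open>?k\<close>,
    which joins \<open>?m\<close>.\<close>
  also have "expectation (\<lambda>\<omega>. trace (A (?x \<omega>) ** transpose (mat_pow S ?k ** C (?x \<omega>)) ** mat_pow S ?m)) =
      expectation (\<lambda>\<omega>. trace (word S (u @ [(q, k q + m q)]) (?x \<omega>) **
        word S (zip (rev [1..<Suc q]) (map m (rev [1..<q]) @ [?k + ?m])) (?x \<omega>)))"
  proof (rule Bochner_Integration.integral_cong[OF refl], rule arg_cong[where f = trace])
    fix \<omega>
    \<comment> \<open>The indices descend from \<open>q\<close> to 1, while the exponents start one
      step later at \<open>m (q - 1)\<close> and end with the merged power.\<close>
    have "zip (q # rev (map fst v)) (rev (map snd v) @ [?k + ?m]) = zip (rev [1..<Suc q]) (map m (rev [1..<q]) @ [?k + ?m])"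
      using q by (simp add: v_def comp_def rev_map)
    then have "word S (zip (rev [1..<Suc q]) (map m (rev [1..<q]) @ [?k + ?m])) (?x \<omega>) =
        outer_square (X q \<omega>) ** transpose (word S v (?x \<omega>)) ** mat_pow S (?k + ?m)"
      using transpose_word[OF sym, of "?x \<omega>" q v "?k + ?m"] by simp
    then show "A (?x \<omega>) ** transpose (mat_pow S ?k ** C (?x \<omega>)) ** mat_pow S ?m =
        word S (u @ [(q, k q + m q)]) (?x \<omega>) ** word S (zip (rev [1..<Suc q]) (map m (rev [1..<q]) @ [?k + ?m])) (?x \<omega>)"
      by (simp add: A_def C_def word_snoc matrix_transpose_mul transpose_outer_square transpose_mat_pow[OF sym]
          mat_pow_add matrix_mul_assoc del: upt_Suc)
  qed
  also have "\<dots> = N_trace P X S q (map k [1..<q] @ [k q + m q]) (map m (rev [1..<q]) @ [?k + ?m])"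
    unfolding u_def zip_upt_snoc[OF q, symmetric] by (rule N_trace_word[symmetric]) (use q in simp_all)
  also have "expectation (\<lambda>\<omega>. trace (mat_pow S ?k ** C (?x \<omega>)) * trace (A (?x \<omega>) ** mat_pow S ?m)) =
      expectation (\<lambda>\<omega>. trace (word S (u @ [(q, k q + ?m)]) (?x \<omega>) ** word S (v @ [(q, m q + ?k)]) (?x \<omega>)))"
  proof (rule Bochner_Integration.integral_cong[OF refl])
    fix \<omega>
    \<comment> \<open>For \<open>q = 1\<close> both prefixes are empty and the heads carry index
      \<open>q\<close>; otherwise both carry index 1.\<close>
    have "fst (hd (u @ [(q, k q + ?m)])) = fst (hd (v @ [(q, m q + ?k)]))"
      by (simp add: u_def v_def hd_append hd_map)
    then have "trace (word S (u @ [(q, k q + ?m)]) (?x \<omega>)) * trace (word S (v @ [(q, m q + ?k)]) (?x \<omega>)) =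
        trace (word S (u @ [(q, k q + ?m)]) (?x \<omega>) ** word S (v @ [(q, m q + ?k)]) (?x \<omega>))"
      by (intro trace_word_mult) simp_all
    then show "trace (mat_pow S ?k ** C (?x \<omega>)) * trace (A (?x \<omega>) ** mat_pow S ?m) =
        trace (word S (u @ [(q, k q + ?m)]) (?x \<omega>) ** word S (v @ [(q, m q + ?k)]) (?x \<omega>))"
      \<comment> \<open>Cyclicity moves \<open>mat_pow S ?k\<close> behind \<open>C\<close>, where
        it raises the last exponent.\<close>
      by (simp add: A_def C_def word_snoc_mat_pow trace_mul_sym[of "mat_pow S _" "word S _ _"] mult.commute)
  qed
  also have "\<dots> = M_trace P X S q (map k [1..<q] @ [k q + ?m]) (map m [1..<q] @ [m q + ?k])"
    unfolding u_def v_def zip_upt_snoc[OF q, symmetric] by (rule M_trace_word[symmetric]) (use q in simp_all)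
  finally show ?thesis .
qed

lemma N_trace_Suc:
  assumes sym: "transpose S = S" and q: "1 \<le> q"
  shows "N_trace P X S (q + 1) (map k [1..<q] @ [k q, k (q + 1)]) (m (q + 1) # map m (rev [1..<Suc q])) =
      2 * N_trace P X S q (map k [1..<q] @ [k q + k (q + 1) + m (q + 1)]) (map m (rev [1..<Suc q]))
    + trace (mat_pow S (k (q + 1))) *
      N_trace P X S q (map k [1..<q] @ [k q + m (q + 1)]) (map m (rev [1..<Suc q]))"
proof -
  define u where "u = map (\<lambda>i. (i, k i)) [1..<q]"
  define w where "w = zip (rev [1..<Suc q]) (map m (rev [1..<Suc q]))"
  let ?x = "\<lambda>\<omega> i. X i \<omega>"
  let ?k = "k (q + 1)" and ?m = "m (q + 1)"
  \<comment> \<open>The second word starts with \<open>X (Suc q)\<close> and the first one ends with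
    it, so only a power of \<open>S\<close> lies between the two occurrences.\<close>
  have w_Cons: "zip (rev [1..<Suc (q + 1)]) (?m # map m (rev [1..<Suc q])) = (Suc q, ?m) # w"
    by (simp add: w_def)
  define A where "A = word S (u @ [(q, k q)])"
  have uw: "fst ` set (u @ [(q, k q)]) \<subseteq> {1..q}" "fst ` set w \<subseteq> {1..q}"
    using q by (auto simp: u_def w_def dest!: set_zip_leftD simp del: upt_Suc)
  have polys: "poly_mat {1..q} A" "poly_mat {1..q} (\<lambda>x. mat_pow S ?m ** word S w x)"
    unfolding A_def by (intro poly_mat_mult poly_mat_const poly_mat_word uw)+
  have N: "expectation (\<lambda>\<omega>. trace (word S (u @ [(q, r)]) (?x \<omega>) ** word S w (?x \<omega>))) =
      N_trace P X S q (map k [1..<q] @ [r]) (map m (rev [1..<Suc q]))" for r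
    unfolding u_def w_def zip_upt_snoc[OF q, symmetric] by (rule N_trace_word[symmetric]) (use q in simp_all)
  have "N_trace P X S (q + 1) (map k [1..<q] @ [k q, ?k]) (?m # map m (rev [1..<Suc q])) =
      expectation (\<lambda>\<omega>. trace (word S (u @ [(q, k q), (Suc q, ?k)]) (?x \<omega>) ** word S ((Suc q, ?m) # w) (?x \<omega>)))"
    unfolding u_def w_Cons[symmetric] zip_upt_snoc2[OF q, symmetric] by (rule N_trace_word) (use q in simp_all)
  also have "\<dots> = expectation (\<lambda>\<omega>. trace (A (?x \<omega>) ** outer_square (X (Suc q) \<omega>) ** mat_pow S ?k
      ** outer_square (X (Suc q) \<omega>) ** (mat_pow S ?m ** word S w (?x \<omega>))))"
    by (simp add: A_def word_append word_Cons matrix_mul_assoc)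
  also have "\<dots> =
      expectation (\<lambda>\<omega>. trace (A (?x \<omega>) ** mat_pow S ?k ** (mat_pow S ?m ** word S w (?x \<omega>))))
    + expectation (\<lambda>\<omega>. trace (A (?x \<omega>) ** transpose (mat_pow S ?k) ** (mat_pow S ?m ** word S w (?x \<omega>))))
    + expectation (\<lambda>\<omega>. trace (mat_pow S ?k) * trace (A (?x \<omega>) ** (mat_pow S ?m ** word S w (?x \<omega>))))"
    by (rule expectation_outer_square_sandwich[OF polys(1) poly_mat_const polys(2)])
  \<comment> \<open>The block is symmetric, so the first two summands coincide; its trace is
    deterministic and leaves the expectation.\<close>
  also have "\<dots> = 2 * expectation (\<lambda>\<omega>. trace (word S (u @ [(q, k q + ?k + ?m)]) (?x \<omega>) ** word S w (?x \<omega>)))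
      + trace (mat_pow S ?k) * expectation (\<lambda>\<omega>. trace (word S (u @ [(q, k q + ?m)]) (?x \<omega>) ** word S w (?x \<omega>)))"
    unfolding word_snoc_mat_pow[symmetric] A_def transpose_mat_pow[OF sym] by (simp add: matrix_mul_assoc)
  finally show ?thesis
    unfolding N .
qed

end

theorem lemma4p1:
  fixes P :: "'a measure"
    and X :: "nat \<Rightarrow> 'a \<Rightarrow> real^'d"
    and B :: "real^'d^'n"
    and S :: "real^'d^'d"
  assumes iid: "iid_std_gaussian P X"
    and S: "S = transpose B ** B"
  shows
    "(\<forall>k m :: nat.
        M_trace P X S 1 [k] [m] =
          2 * trace (mat_pow S (k + m)) + trace (mat_pow S k) * trace (mat_pow S m) \<and>
        N_trace P X S 1 [k] [m] =
          2 * trace (mat_pow S (k + m)) + trace (mat_pow S k) * trace (mat_pow S m)) \<and>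
     (\<forall>(q::nat) (k :: nat \<Rightarrow> nat) (m :: nat \<Rightarrow> nat). q \<ge> 1 \<longrightarrow>
        M_trace P X S (q + 1) (map k [1..<q] @ [k q, k (q + 1)]) (map m [1..<q] @ [m q, m (q + 1)]) =
          M_trace P X S q (map k [1..<q] @ [k q + k (q + 1)]) (map m [1..<q] @ [m q + m (q + 1)])
        + N_trace P X S q (map k [1..<q] @ [k q + m q]) (map m (rev [1..<q]) @ [k (q + 1) + m (q + 1)])
        + M_trace P X S q (map k [1..<q] @ [k q + m (q + 1)]) (map m [1..<q] @ [m q + k (q + 1)])) \<and>
     (\<forall>(q::nat) (k :: nat \<Rightarrow> nat) (m :: nat \<Rightarrow> nat). q \<ge> 1 \<longrightarrow>
        N_trace P X S (q + 1) (map k [1..<q] @ [k q, k (q + 1)]) (m (q + 1) # map m (rev [1..<Suc q])) =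
          2 * N_trace P X S q (map k [1..<q] @ [k q + k (q + 1) + m (q + 1)]) (map m (rev [1..<Suc q]))
        + trace (mat_pow S (k (q + 1))) *
          N_trace P X S q (map k [1..<q] @ [k q + m (q + 1)]) (map m (rev [1..<Suc q])))"
proof -
  interpret std_gaussian_sequence P X
    using iid by unfold_locales
  have sym: "transpose S = S"
    by (simp add: S matrix_transpose_mul)
  \<comment> \<open>Reversing a single index changes nothing: \<open>q + 1 - i\<close> is 1 for
    \<open>q = i = 1\<close>.\<close>
  have "N_trace P X S 1 [k] [m] = M_trace P X S 1 [k] [m]" for k m
    by (simp add: M_trace_def N_trace_def)
  then show ?thesis
    using M_trace_1[OF sym] M_trace_Suc[OF sym] N_trace_Suc[OF sym] by simp
qed

end
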